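(* Let $k\ge 1$, let $\Sigma$ be a totally ordered alphabet of $k$ symbols, let $N$ be a finite non-empty totally ordered set with $n$ elements, and let $(Q_j)$ be a $2m^k$-parking function on $N$. The non-initial ADFA $\zeta((Q_j))$ (with $\zeta$ as defined in the context) is simple and coreachable if and only if $\#Q_j\le 1$ for every $j\in\{1,\dots,2n^k\}$ and $Q_1=\varnothing$ (the empty set).
   Context: Parking functions. A $2m^k$-parking function on $N$ is encoded as a sequence $(Q_j)_{1\le j\le 2n^k}$ of pairwise disjoint (possibly empty) subsets of $N$ with union $N$ such that $\sum_{j=1}^{2p^k}\#Q_j\ge p$ for all $p\in\{1,\dots,n\}$. Automata. A non-initial DFA with state set $N$ over $\Sigma$ is a pair $(A,\delta)$ with $A\subseteq N$ (accepting states) and $\delta:N\times\Sigma\to N\cup\{\emptyset\}$, where $\emptyset\notin N$ is a special symbol, the (non-accepting) absorbing state. $\delta$ is extended to words by $\delta^*(q,\epsilon)=q$, $\delta^*(q,aw)=\delta^*(\delta(q,a),w)$, $\delta^*(\emptyset,w)=\emptyset$. It is acyclic (a non-initial ADFA) if no non-empty sequence of transitions leads from a state of $N$ back to itself. The right language of $q\in N$ is $RL(q)=\{w\in\Sigma^*:\delta^*(q,w)\in A\}$. The automaton is simple if $RL(q)\neq RL(r)$ for all distinct $q,r\in N$, and coreachable if for every $q\in N$ there is $w\in\Sigma^*$ with $\delta^*(q,w)\in A$. For $q\in N$, $\delta_q:\Sigma\to N\cup\{\emptyset\}$ is $\delta_q(a)=\delta(q,a)$. The map $\zeta$. Let $<_N$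 be the given total order on $N$ and $a_1<\dots<a_k$ the symbols of $\Sigma$. Given a $2m^k$-parking function $(Q_j)$ on $N$, define a total order $<_q$ on $N$ by: $x<_q y$ iff $x\in Q_j$, $y\in Q_{j'}$ with $j<j'$, or $x,y\in Q_j$ for the same $j$ and $x<_N y$. Let $q_1<_q q_2<_q\dots<_q q_n$ be the elements of $N$ and put $q_0:=\emptyset$, with $q_0<_q q_1$. For $p\in\{1,\dots,n\}$ there are exactly $p^k-(p-1)^k$ maps $\nu:\Sigma\to\{q_0,q_1,\dots,q_{p-1}\}$ with $\nu(a)=q_{p-1}$ for at least one $a\in\Sigma$; let $\nu^{(p)}_1<\nu^{(p)}_2<\dots<\nu^{(p)}_{p^k-(p-1)^k}$ be these maps, ordered lexicographically by the words $\nu(a_1)\nu(a_2)\cdots\nu(a_k)$ with letters ordered by $<_q$. Then $\zeta((Q_j)):=(A,\delta)$, where $A$ is the union of the $Q_j$ with $j$ even, and for $q\in N$, $\delta_q:=\nu^{(p)}_j$ for the unique $p\in\{1,\dots,n\}$ and $j\in\{1,\dots,p^k-(p-1)^k\}$ such that $q\in Q_{2(p-1)^k+2j-1}$ or $q\in Q_{2(p-1)^k+2j}$. The structure $\zeta((Q_j))$ is always a non-initial ADFA. *)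

theory Defs
  imports "HOL-Library.FuncSet" "HOL-Library.Disjoint_Sets"
begin

section \<open>Parking functions\<close>

text \<open>A sequence is a function on \<^typ>\<open>nat\<close> of which only the values at the indices
  \<open>1, \<dots>, 2 * card N ^ k\<close> matter.\<close>

definition parking_function :: "nat \<Rightarrow> 'q set \<Rightarrow> (nat \<Rightarrow> 'q set) \<Rightarrow> bool" where
  "parking_function k N Q \<longleftrightarrow>
     disjoint_family_on Q {1..2 * card N ^ k} \<and>
     (\<Union>j\<in>{1..2 * card N ^ k}. Q j) = N \<and>
     (\<forall>p\<in>{1..card N}. p \<le> (\<Sum>j = 1..2 * p ^ k. card (Q j)))"

section \<open>Non-initial automata\<close>

text \<open>The absorbing state is \<^term>\<open>None\<close>; a state \<open>q\<close> of \<open>N\<close> is \<open>Some q\<close>. The transition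
  function is only relevant on \<open>N\<close> and on the alphabet.\<close>

type_synonym ('q, 'a) dfa = "'q set \<times> ('q \<Rightarrow> 'a \<Rightarrow> 'q option)"

fun delta_star :: "('q \<Rightarrow> 'a \<Rightarrow> 'q option) \<Rightarrow> 'q option \<Rightarrow> 'a list \<Rightarrow> 'q option" where
  "delta_star \<delta> None w = None"
| "delta_star \<delta> (Some q) [] = Some q"
| "delta_star \<delta> (Some q) (a # w) = delta_star \<delta> (\<delta> q a) w"

definition right_language :: "'a set \<Rightarrow> ('q, 'a) dfa \<Rightarrow> 'q \<Rightarrow> 'a list set" where
  "right_language \<Sigma> M q = {w \<in> lists \<Sigma>. delta_star (snd M) (Some q) w \<in> Some ` fst M}"

definition simple :: "'a set \<Rightarrow> 'q set \<Rightarrow> ('q, 'a) dfa \<Rightarrow> bool" where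
  "simple \<Sigma> N M \<longleftrightarrow>
     (\<forall>q\<in>N. \<forall>r\<in>N. q \<noteq> r \<longrightarrow> right_language \<Sigma> M q \<noteq> right_language \<Sigma> M r)"

definition coreachable :: "'a set \<Rightarrow> 'q set \<Rightarrow> ('q, 'a) dfa \<Rightarrow> bool" where
  "coreachable \<Sigma> N M \<longleftrightarrow>
     (\<forall>q\<in>N. \<exists>w\<in>lists \<Sigma>. delta_star (snd M) (Some q) w \<in> Some ` fst M)"

section \<open>The map \<open>\<zeta>\<close>\<close>

text \<open>The increasing enumeration of a finite set with respect to a strict order that is
  total on it. It is indexed from 0, whereas the sequences below start at 1.\<close>

definition enumeration :: "('b \<Rightarrow> 'b \<Rightarrow> bool) \<Rightarrow> 'b set \<Rightarrow> 'b list" where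
  "enumeration R S = (THE xs. sorted_wrt R xs \<and> set xs = S)"

definition less_q :: "nat \<Rightarrow> 'q::linorder set \<Rightarrow> (nat \<Rightarrow> 'q set) \<Rightarrow> 'q \<Rightarrow> 'q \<Rightarrow> bool" where
  "less_q k N Q x y \<longleftrightarrow>
     (\<exists>j\<in>{1..2 * card N ^ k}. \<exists>j'\<in>{1..2 * card N ^ k}.
        x \<in> Q j \<and> y \<in> Q j' \<and> (j < j' \<or> j = j' \<and> x < y))"

definition q_seq :: "nat \<Rightarrow> 'q::linorder set \<Rightarrow> (nat \<Rightarrow> 'q set) \<Rightarrow> nat \<Rightarrow> 'q option" where
  "q_seq k N Q i = (if i = 0 then None else Some (enumeration (less_q k N Q) N ! (i - 1)))"

fun less_q_option ::
  "nat \<Rightarrow> 'q::linorder set \<Rightarrow> (nat \<Rightarrow> 'q set) \<Rightarrow> 'q option \<Rightarrow> 'q option \<Rightarrow> bool" where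
  "less_q_option k N Q (Some x) (Some y) = less_q k N Q x y"
| "less_q_option k N Q None (Some y) = True"
| "less_q_option k N Q _ None = False"

definition less_nu ::
  "'a::linorder set \<Rightarrow> 'q::linorder set \<Rightarrow> (nat \<Rightarrow> 'q set) \<Rightarrow>
     ('a \<Rightarrow> 'q option) \<Rightarrow> ('a \<Rightarrow> 'q option) \<Rightarrow> bool" where
  "less_nu \<Sigma> N Q \<nu> \<nu>' \<longleftrightarrow>
     (map \<nu> (sorted_list_of_set \<Sigma>), map \<nu>' (sorted_list_of_set \<Sigma>))
       \<in> lexord {(s, t). less_q_option (card \<Sigma>) N Q s t}"

definition nu_set ::
  "'a::linorder set \<Rightarrow> 'q::linorder set \<Rightarrow> (nat \<Rightarrow> 'q set) \<Rightarrow> nat \<Rightarrow> ('a \<Rightarrow> 'q option) set" where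
  "nu_set \<Sigma> N Q p =
     {\<nu> \<in> \<Sigma> \<rightarrow>\<^sub>E q_seq (card \<Sigma>) N Q ` {0..p - 1}.
        \<exists>a\<in>\<Sigma>. \<nu> a = q_seq (card \<Sigma>) N Q (p - 1)}"

definition nu ::
  "'a::linorder set \<Rightarrow> 'q::linorder set \<Rightarrow> (nat \<Rightarrow> 'q set) \<Rightarrow> nat \<Rightarrow> nat \<Rightarrow> 'a \<Rightarrow> 'q option" where
  "nu \<Sigma> N Q p j = enumeration (less_nu \<Sigma> N Q) (nu_set \<Sigma> N Q p) ! (j - 1)"

definition zeta_index :: "nat \<Rightarrow> 'q set \<Rightarrow> (nat \<Rightarrow> 'q set) \<Rightarrow> 'q \<Rightarrow> nat \<times> nat" where
  "zeta_index k N Q q =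
     (THE (p, j). p \<in> {1..card N} \<and> j \<in> {1..p ^ k - (p - 1) ^ k} \<and>
        (q \<in> Q (2 * (p - 1) ^ k + 2 * j - 1) \<or> q \<in> Q (2 * (p - 1) ^ k + 2 * j)))"

definition zeta ::
  "'a::linorder set \<Rightarrow> 'q::linorder set \<Rightarrow> (nat \<Rightarrow> 'q set) \<Rightarrow> ('q, 'a) dfa" where
  "zeta \<Sigma> N Q =
     (\<Union>j\<in>{j \<in> {1..2 * card N ^ card \<Sigma>}. even j}. Q j,
      \<lambda>q. case zeta_index (card \<Sigma>) N Q q of (p, j) \<Rightarrow> nu \<Sigma> N Q p j)"

end

theory Submission
  imports Defs
begin

text \<open>
  Each state of an automaton has two local data: whether it accepts, and its row of
  transitions. Suppose the automaton is acyclic. If these data separate states, and no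
  state is dead (non-accepting with every transition going to the absorbing state), then
  induction along the transitions shows that every state accepts some word and that distinct
  states have distinct right languages. The converse holds because two states with equal data
  have equal right languages, and a dead state has an empty one. So simplicity together with
  coreachability is a purely local condition (\<open>simple_coreachable_iff\<close>).

  For \<open>\<zeta>(Q)\<close>, the local data of a state in \<open>Q i\<close> are exactly the index \<open>i\<close>: its parity is
  acceptance, and the pair \<open>{2c - 1, 2c}\<close> containing it is the row of transitions, since
  \<open>c = (p - 1)^k + j\<close> encodes the \<open>j\<close>-th map \<open>\<nu>\<close> of level \<open>p\<close>, and these maps are pairwise
  different (\<open>zeta_accepting_iff\<close>, \<open>zeta_transitions_eq_iff\<close>). Hence states are separated if and
  only if no \<open>Q i\<close> has two elements. The only level whose maps do not reach a state is \<open>p = 1\<close>;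
  it owns the indices 1 and 2, so the dead states are those of \<open>Q 1\<close>.

  Acyclicity is where the parking condition enters (\<open>zeta_step\<close>): a state whose row has level
  \<open>p\<close> only points to the first \<open>p - 1\<close> states of the order \<open><\<^sub>q\<close>, whereas the parking condition
  puts at least \<open>p - 1\<close> states before it.
\<close>

section \<open>Enumerations of finite strictly ordered sets\<close>

lemma sorted_wrt_set_unique:
  assumes "transp R" "irreflp R"
    and "sorted_wrt R xs" "sorted_wrt R ys" "set xs = set ys"
  shows "xs = ys"
  using assms(3-)
proof (induction xs arbitrary: ys)
  case Nil
  then show ?case by simp
next
  case (Cons x xs)
  from Cons.prems(3) obtain y ys' where ys: "ys = y # ys'" by (cases ys) auto
  have irr: "\<not> R z z" for z using assms(2) by (auto simp: irreflp_def)
  have "x = y"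
  proof -
    have "x \<in> set (y # ys')" "y \<in> set (x # xs)" using Cons.prems(3) unfolding ys by auto
    then show ?thesis
      using Cons.prems(1,2) irr transpD[OF assms(1), of x y x] unfolding ys by auto
  qed
  moreover from this have "set xs = set ys'"
  proof -
    have "x \<notin> set xs" "x \<notin> set ys'"
      using Cons.prems(1,2) irr \<open>x = y\<close> unfolding ys by auto
    then show ?thesis
      using Cons.prems(3) \<open>x = y\<close> unfolding ys by (simp add: insert_ident)
  qed
  ultimately show ?case
    using Cons.IH[of ys'] Cons.prems ys by auto
qed

lemma ex_sorted_wrt_set:
  assumes "finite S" "transp R" "totalp_on S R"
  shows "\<exists>xs. sorted_wrt R xs \<and> set xs = S"
  using assms(1,3)
proof (induction "card S" arbitrary: S)
  case 0
  then show ?case by (intro exI[of _ "[]"]) simp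
next
  case (Suc m)
  have trans: "transp_on S R" using assms(2) by (auto simp: transp_on_def)
  obtain l where l: "l \<in> S" "\<forall>x\<in>S. x \<noteq> l \<longrightarrow> R l x"
    using Finite_Set.bex_least_element[OF Suc.prems(1) _ trans Suc.prems(2)] Suc.hyps(2) by fastforce
  have "totalp_on (S - {l}) R"
    using Suc.prems(2) by (auto simp: totalp_on_def)
  then obtain xs where "sorted_wrt R xs" "set xs = S - {l}"
    using Suc.hyps(1)[of "S - {l}"] Suc.hyps(2)[symmetric] Suc.prems(1) l(1) by auto
  with l show ?case by (intro exI[of _ "l # xs"]) auto
qed

text \<open>The definite description in \<^const>\<open>enumeration\<close> is well defined. Totality is confined to the
  enumerated set because \<^const>\<open>less_q\<close> does not relate elements outside \<open>N\<close>, and \<^const>\<open>less_nu\<close>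
  inherits this.\<close>

lemma enumeration_sorted:
  assumes "finite S" "transp R" "irreflp R" "totalp_on S R"
  shows "sorted_wrt R (enumeration R S)" "set (enumeration R S) = S"
proof -
  have "\<exists>!xs. sorted_wrt R xs \<and> set xs = S"
    using ex_sorted_wrt_set[OF assms(1,2,4)] sorted_wrt_set_unique[OF assms(2,3)] by metis
  then have "sorted_wrt R (enumeration R S) \<and> set (enumeration R S) = S"
    unfolding enumeration_def by (rule theI')
  then show "sorted_wrt R (enumeration R S)" "set (enumeration R S) = S" by auto
qed

lemma distinct_sorted_wrt: "irreflp R \<Longrightarrow> sorted_wrt R xs \<Longrightarrow> distinct xs"
  by (induction xs) (auto simp: irreflp_def)

lemma enumeration_distinct:
  assumes "finite S" "transp R" "irreflp R" "totalp_on S R"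
  shows "distinct (enumeration R S)" "length (enumeration R S) = card S"
proof -
  show "distinct (enumeration R S)"
    using distinct_sorted_wrt[OF assms(3)] enumeration_sorted(1)[OF assms] .
  then show "length (enumeration R S) = card S"
    using enumeration_sorted(2)[OF assms] distinct_card by metis
qed

text \<open>Equal length excludes that one word is a proper prefix of the other, so two different words
  differ at some letter, and comparability of letters from \<open>T\<close> is enough.\<close>

lemma lexord_total_on:
  assumes "length xs = length ys" "set xs \<subseteq> T" "set ys \<subseteq> T" "xs \<noteq> ys"
    and "\<And>x y. x \<in> T \<Longrightarrow> y \<in> T \<Longrightarrow> x \<noteq> y \<Longrightarrow> (x, y) \<in> r \<or> (y, x) \<in> r"
  shows "(xs, ys) \<in> lexord r \<or> (ys, xs) \<in> lexord r"
  using assms(1-4) by (induction xs ys rule: list_induct2) (auto dest: assms(5))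

section \<open>Acyclic automata\<close>

lemma Nil_in_right_language [simp]:
  "[] \<in> right_language \<Sigma> M q \<longleftrightarrow> q \<in> fst M"
  by (auto simp: right_language_def)

lemma Cons_in_right_language:
  "a # w \<in> right_language \<Sigma> M q \<longleftrightarrow>
     a \<in> \<Sigma> \<and> (\<exists>r. snd M q a = Some r \<and> w \<in> right_language \<Sigma> M r)"
  by (cases "snd M q a") (auto simp: right_language_def)

lemma coreachable_iff_right_language:
  "coreachable \<Sigma> N M \<longleftrightarrow> (\<forall>q\<in>N. right_language \<Sigma> M q \<noteq> {})"
  unfolding coreachable_def right_language_def by blast

text \<open>A right language is determined by acceptance and by the transitions: they decide the empty
  word and reduce every other word to the language of a successor.\<close>

lemma right_language_cong:
  assumes "q \<in> fst M \<longleftrightarrow> r \<in> fst M" "\<And>a. a \<in> \<Sigma> \<Longrightarrow> snd M q a = snd M r a"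
  shows "right_language \<Sigma> M q = right_language \<Sigma> M r"
proof (rule set_eqI)
  fix w
  show "w \<in> right_language \<Sigma> M q \<longleftrightarrow> w \<in> right_language \<Sigma> M r"
    using assms by (cases w) (auto simp: Cons_in_right_language)
qed

text \<open>A rank that decreases along transitions expresses acyclicity. Following transitions into
  \<open>N\<close> as long as the current state does not accept must then end in an accepting state.\<close>

lemma coreachable_if_no_dead_state:
  fixes rank :: "'q \<Rightarrow> nat"
  assumes step: "\<And>q a r. q \<in> N \<Longrightarrow> a \<in> \<Sigma> \<Longrightarrow> snd M q a = Some r \<Longrightarrow> r \<in> N \<and> rank r < rank q"
    and live: "\<forall>q\<in>N. q \<in> fst M \<or> (\<exists>a\<in>\<Sigma>. snd M q a \<noteq> None)"
  shows "coreachable \<Sigma> N M"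
proof -
  have "q \<in> N \<Longrightarrow> right_language \<Sigma> M q \<noteq> {}" for q
  proof (induction "rank q" arbitrary: q rule: less_induct)
    case less
    show ?case
    proof (cases "q \<in> fst M")
      case True
      then have "[] \<in> right_language \<Sigma> M q" by simp
      then show ?thesis by blast
    next
      case False
      then obtain a r where ar: "a \<in> \<Sigma>" "snd M q a = Some r" using live less.prems by blast
      then have "right_language \<Sigma> M r \<noteq> {}"
        using step[OF less.prems ar] less.hyps[of r] by blast
      then obtain w where "w \<in> right_language \<Sigma> M r" by blast
      then have "a # w \<in> right_language \<Sigma> M q" using ar by (simp add: Cons_in_right_language)
      then show ?thesis by blast
    qed
  qed
  then show ?thesis by (simp add: coreachable_iff_right_language)
qed

text \<open>Equal right languages force equal acceptance (the empty word) and successors with equal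
  right languages (the left quotients by a symbol). The successors are equal by induction on the
  rank; coreachability is what separates a successor in \<open>N\<close> from the absorbing state, whose
  language is empty.\<close>

lemma simple_if_state_determined:
  fixes rank :: "'q \<Rightarrow> nat"
  assumes step: "\<And>q a r. q \<in> N \<Longrightarrow> a \<in> \<Sigma> \<Longrightarrow> snd M q a = Some r \<Longrightarrow> r \<in> N \<and> rank r < rank q"
    and cor: "coreachable \<Sigma> N M"
    and det: "\<forall>q\<in>N. \<forall>r\<in>N. (q \<in> fst M \<longleftrightarrow> r \<in> fst M) \<and> (\<forall>a\<in>\<Sigma>. snd M q a = snd M r a) \<longrightarrow> q = r"
  shows "simple \<Sigma> N M"
proof -
  have "q \<in> N \<Longrightarrow> r \<in> N \<Longrightarrow> right_language \<Sigma> M q = right_language \<Sigma> M r \<Longrightarrow> q = r" for q r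
  proof (induction "rank q" arbitrary: q r rule: less_induct)
    case less
    note eq = less.prems(3)
    have "q \<in> fst M \<longleftrightarrow> r \<in> fst M" using eq Nil_in_right_language by metis
    moreover have "snd M q a = snd M r a" if a: "a \<in> \<Sigma>" for a
    proof -
      \<comment> \<open>The left quotients by \<open>a\<close> agree; they are empty exactly when the target is absorbing.\<close>
      have quotients: "(\<exists>q'. snd M q a = Some q' \<and> w \<in> right_language \<Sigma> M q') \<longleftrightarrow>
            (\<exists>r'. snd M r a = Some r' \<and> w \<in> right_language \<Sigma> M r')" for w
        using eq a Cons_in_right_language[of a w \<Sigma> M] by blast
      have nonempty: "s \<in> N \<Longrightarrow> right_language \<Sigma> M s \<noteq> {}" for s
        using cor by (simp add: coreachable_iff_right_language)
      show ?thesis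
      proof (cases "snd M q a")
        case None
        then show ?thesis
          using quotients step[OF less.prems(2) a] nonempty by (cases "snd M r a") fastforce+
      next
        case (Some q')
        then have q': "q' \<in> N" "rank q' < rank q" using step[OF less.prems(1) a] by auto
        then obtain r' where r': "snd M r a = Some r'"
          using quotients nonempty Some by blast
        then have "right_language \<Sigma> M q' = right_language \<Sigma> M r'"
          using quotients Some by auto
        then show ?thesis
          using less.hyps[OF q'(2,1)] step[OF less.prems(2) a] r' Some by simp
      qed
    qed
    ultimately show ?case using det less.prems by blast
  qed
  then show ?thesis unfolding simple_def by blast
qed

lemma simple_coreachable_iff:
  fixes rank :: "'q \<Rightarrow> nat"
  assumes step: "\<And>q a r. q \<in> N \<Longrightarrow> a \<in> \<Sigma> \<Longrightarrow> snd M q a = Some r \<Longrightarrow> r \<in> N \<and> rank r < rank q"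
  shows "simple \<Sigma> N M \<and> coreachable \<Sigma> N M \<longleftrightarrow>
    (\<forall>q\<in>N. \<forall>r\<in>N. (q \<in> fst M \<longleftrightarrow> r \<in> fst M) \<and> (\<forall>a\<in>\<Sigma>. snd M q a = snd M r a) \<longrightarrow> q = r) \<and>
    (\<forall>q\<in>N. q \<in> fst M \<or> (\<exists>a\<in>\<Sigma>. snd M q a \<noteq> None))" (is "?L \<longleftrightarrow> ?det \<and> ?live")
proof
  assume L: ?L
  have ?det using L right_language_cong[of _ M _ \<Sigma>] unfolding simple_def by blast
  moreover have ?live
  proof (rule ballI, rule ccontr)
    fix q assume q: "q \<in> N" and dead: "\<not> (q \<in> fst M \<or> (\<exists>a\<in>\<Sigma>. snd M q a \<noteq> None))"
    have "w \<notin> right_language \<Sigma> M q" for w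
      using dead by (cases w) (auto simp: Cons_in_right_language)
    then show False using L q by (auto simp: coreachable_iff_right_language)
  qed
  ultimately show "?det \<and> ?live" ..
next
  assume R: "?det \<and> ?live"
  have cor: "coreachable \<Sigma> N M"
    by (rule coreachable_if_no_dead_state[where rank = rank, OF step conjunct2[OF R]])
  moreover have "simple \<Sigma> N M"
    by (rule simple_if_state_determined[where rank = rank, OF step cor conjunct1[OF R]])
  ultimately show ?L by simp
qed

section \<open>Counting maps with a prescribed value\<close>

text \<open>The maps into \<open>insert b B\<close> that miss \<open>b\<close> are the maps into \<open>B\<close>; this is the count
  \<open>p^k - (p - 1)^k\<close> behind the block lengths of \<open>\<zeta>\<close>.\<close>

lemma card_PiE_hitting:
  assumes "finite A" "finite B" "b \<notin> B"
  shows "card {f \<in> A \<rightarrow>\<^sub>E insert b B. \<exists>a\<in>A. f a = b} = Suc (card B) ^ card A - card B ^ card A"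
proof -
  have "{f \<in> A \<rightarrow>\<^sub>E insert b B. \<exists>a\<in>A. f a = b} = (A \<rightarrow>\<^sub>E insert b B) - (A \<rightarrow>\<^sub>E B)"
    unfolding set_eq_iff Diff_iff mem_Collect_eq PiE_iff using assms(3) by (metis insert_iff)
  moreover have "(A \<rightarrow>\<^sub>E B) \<subseteq> (A \<rightarrow>\<^sub>E insert b B)"
    by (intro PiE_mono) auto
  ultimately show ?thesis
    using assms by (simp add: card_Diff_subset card_funcsetE finite_PiE)
qed

section \<open>Blocks of indices\<close>

text \<open>For \<open>k \<ge> 1\<close> the intervals \<open>{(p - 1)^k + 1..p^k}\<close>, \<open>1 \<le> p \<le> n\<close>, partition \<open>{1..n^k}\<close>. This decodes a position
  into the level \<open>p\<close> and the offset \<open>j\<close> inside that level.\<close>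

lemma power_block_exists:
  fixes c n k :: nat
  assumes "1 \<le> c" "c \<le> n ^ k" "1 \<le> k"
  obtains p j where "p \<in> {1..n}" "j \<in> {1..p ^ k - (p - 1) ^ k}" "c = (p - 1) ^ k + j"
proof -
  define p where "p = (LEAST p. c \<le> p ^ k)"
  have p: "c \<le> p ^ k" "p \<le> n"
    unfolding p_def by (rule LeastI[where P = "\<lambda>p. c \<le> p ^ k", OF assms(2)],
      rule Least_le[where P = "\<lambda>p. c \<le> p ^ k", OF assms(2)])
  have "p \<noteq> 0" using p(1) assms(1,3) by (intro notI) (simp add: power_0_left)
  then have "(p - 1) ^ k < c"
    using not_less_Least[of "p - 1" "\<lambda>p. c \<le> p ^ k"] unfolding p_def[symmetric] by simp
  then have "1 \<le> c - (p - 1) ^ k" "c - (p - 1) ^ k \<le> p ^ k - (p - 1) ^ k" "c = (p - 1) ^ k + (c - (p - 1) ^ k)"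
    using p(1) by linarith+
  with p(2) \<open>p \<noteq> 0\<close> show thesis
    by (intro that[of p "c - (p - 1) ^ k"]) auto
qed

lemma power_block_unique:
  fixes p p' j j' k :: nat
  assumes "j \<in> {1..p ^ k - (p - 1) ^ k}" "j' \<in> {1..p' ^ k - (p' - 1) ^ k}"
    and "(p - 1) ^ k + j = (p' - 1) ^ k + j'"
  shows "p = p' \<and> j = j'"
proof -
  have below: "\<not> u < v"
    if "i \<in> {1..u ^ k - (u - 1) ^ k}" "i' \<in> {1..v ^ k - (v - 1) ^ k}"
      "(u - 1) ^ k + i = (v - 1) ^ k + i'" for u v i i' :: nat
  proof
    assume "u < v"
    then have "u ^ k \<le> (v - 1) ^ k" by (intro power_mono) auto
    then show False using that by auto
  qed
  have "p = p'" using below[OF assms] below[OF assms(2,1) assms(3)[symmetric]] by simp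
  then show ?thesis using assms(3) by simp
qed

section \<open>The order of the states\<close>

locale parking =
  fixes \<Sigma> :: "'a::linorder set" and N :: "'q::linorder set" and Q :: "nat \<Rightarrow> 'q set"
  assumes finite_alphabet: "finite \<Sigma>" and alphabet_nonempty: "\<Sigma> \<noteq> {}"
    and finite_states: "finite N" and states_nonempty: "N \<noteq> {}"
    and parking: "parking_function (card \<Sigma>) N Q"
begin

abbreviation "k \<equiv> card \<Sigma>"
abbreviation "n \<equiv> card N"
abbreviation "state_less \<equiv> less_q k N Q"
abbreviation "order_list \<equiv> enumeration state_less N"
abbreviation "qs \<equiv> q_seq k N Q"

lemma k_pos: "1 \<le> k"
  using finite_alphabet alphabet_nonempty by (simp add: Suc_leI card_gt_0_iff)

lemma n_pos: "1 \<le> n"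
  using finite_states states_nonempty by (simp add: Suc_leI card_gt_0_iff)

lemma Q_unique: "x \<in> Q i \<Longrightarrow> x \<in> Q j \<Longrightarrow> i \<in> {1..2 * n ^ k} \<Longrightarrow> j \<in> {1..2 * n ^ k} \<Longrightarrow> i = j"
  using parking unfolding parking_function_def disjoint_family_on_def by blast

lemma Q_subset: "i \<in> {1..2 * n ^ k} \<Longrightarrow> Q i \<subseteq> N"
  using parking unfolding parking_function_def by blast

lemma Q_cover: "x \<in> N \<Longrightarrow> \<exists>i\<in>{1..2 * n ^ k}. x \<in> Q i"
  using parking unfolding parking_function_def by blast

lemma state_less_iff:
  assumes "x \<in> Q i" "y \<in> Q j" "i \<in> {1..2 * n ^ k}" "j \<in> {1..2 * n ^ k}"
  shows "state_less x y \<longleftrightarrow> i < j \<or> i = j \<and> x < y"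
  unfolding less_q_def using assms Q_unique by blast

lemma state_less_in_N: "state_less x y \<Longrightarrow> x \<in> N \<and> y \<in> N"
  unfolding less_q_def using Q_subset by blast

lemma transp_state_less: "transp state_less"
proof (rule transpI)
  fix x y z assume xy: "state_less x y" and yz: "state_less y z"
  obtain h i j where "x \<in> Q h" "y \<in> Q i" "z \<in> Q j"
      "h \<in> {1..2 * n ^ k}" "i \<in> {1..2 * n ^ k}" "j \<in> {1..2 * n ^ k}"
    using state_less_in_N xy yz Q_cover by metis
  with xy yz show "state_less x z" by (auto simp: state_less_iff)
qed

lemma irreflp_state_less: "irreflp state_less"
  unfolding irreflp_def using state_less_in_N Q_cover state_less_iff less_irrefl by metis

lemma totalp_state_less: "totalp_on N state_less"
proof (rule totalp_onI)
  fix x y assume "x \<in> N" "y \<in> N" "x \<noteq> y"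
  then show "state_less x y \<or> state_less y x"
    using Q_cover state_less_iff by (metis linorder_less_linear)
qed

lemmas order_list = enumeration_sorted[OF finite_states transp_state_less irreflp_state_less totalp_state_less]
  enumeration_distinct[OF finite_states transp_state_less irreflp_state_less totalp_state_less]

lemma inj_qs: "inj_on qs {0..n}"
proof (rule inj_onI)
  fix i j assume "i \<in> {0..n}" "j \<in> {0..n}" "qs i = qs j"
  then show "i = j"
    using order_list(3,4) by (auto simp: q_seq_def nth_eq_iff_index_eq split: if_splits)
qed

lemma qs_image: "qs ` {0..n} \<subseteq> insert None (Some ` N)"
  using order_list(2,4) by (force simp: q_seq_def set_conv_nth)

lemma qs_eq_None_iff [simp]: "qs i = None \<longleftrightarrow> i = 0"
  by (simp add: q_seq_def)

definition rank :: "'q \<Rightarrow> nat" where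
  "rank q = card {x \<in> N. state_less x q}"

lemma rank_nth:
  assumes "m < n"
  shows "rank (order_list ! m) = m"
proof -
  have lt: "state_less (order_list ! i) (order_list ! m) \<longleftrightarrow> i < m" if "i < n" for i
  proof -
    have "i < m \<Longrightarrow> state_less (order_list ! i) (order_list ! m)"
         "m < i \<Longrightarrow> state_less (order_list ! m) (order_list ! i)"
      using order_list(1,4) assms that by (auto simp: sorted_wrt_iff_nth_less)
    then show ?thesis
      using irreflp_state_less transpD[OF transp_state_less] by (metis irreflp_def linorder_less_linear)
  qed
  have "set order_list = (!) order_list ` {..<length order_list}"
    by (auto simp: set_conv_nth)
  then have states: "N = (!) order_list ` {..<n}" unfolding order_list .
  have "{x \<in> (!) order_list ` {..<n}. state_less x (order_list ! m)} = (!) order_list ` {..<m}"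
    using assms by (auto simp: lt)
  then have "{x \<in> N. state_less x (order_list ! m)} = (!) order_list ` {..<m}"
    unfolding states[symmetric] .
  moreover have "inj_on ((!) order_list) {..<m}"
    using order_list(3,4) assms by (auto simp: inj_on_def nth_eq_iff_index_eq)
  ultimately show ?thesis unfolding rank_def by (simp add: card_image)
qed

text \<open>The parking condition for \<open>p - 1\<close>: the sets with index at most \<open>2 * (p - 1)^k\<close> contain at
  least \<open>p - 1\<close> states, all of which precede \<open>q\<close>.\<close>

lemma rank_ge_of_block:
  assumes q: "q \<in> Q i" and i: "i \<in> {1..2 * n ^ k}" and p: "p \<in> {1..n}" and above: "2 * (p - 1) ^ k < i"
  shows "p - 1 \<le> rank q"
  \<comment> \<open>For \<open>p = 1\<close> the bound is trivial, and there is no parking condition for 0.\<close>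
proof (cases "p = 1")
  case False
  have sub: "{1..2 * (p - 1) ^ k} \<subseteq> {1..2 * n ^ k}" using i above by auto
  have "p - 1 \<in> {1..n}" using p False by auto
  then have "p - 1 \<le> (\<Sum>j = 1..2 * (p - 1) ^ k. card (Q j))"
    using parking unfolding parking_function_def by blast
  also have "\<dots> = card (\<Union>j\<in>{1..2 * (p - 1) ^ k}. Q j)"
  proof (rule card_UN_disjoint[symmetric])
    show "\<forall>j\<in>{1..2 * (p - 1) ^ k}. finite (Q j)"
      using sub Q_subset finite_states finite_subset by blast
    show "\<forall>j\<in>{1..2 * (p - 1) ^ k}. \<forall>j'\<in>{1..2 * (p - 1) ^ k}. j \<noteq> j' \<longrightarrow> Q j \<inter> Q j' = {}"
      using sub Q_unique by blast
  qed simp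
  also have "\<dots> \<le> rank q"
    unfolding rank_def
  proof (rule card_mono)
    show "finite {x \<in> N. state_less x q}" using finite_states by simp
    show "(\<Union>j\<in>{1..2 * (p - 1) ^ k}. Q j) \<subseteq> {x \<in> N. state_less x q}"
    proof
      fix x assume "x \<in> (\<Union>j\<in>{1..2 * (p - 1) ^ k}. Q j)"
      then obtain j where "j \<in> {1..2 * (p - 1) ^ k}" "x \<in> Q j" by blast
      with q i above sub state_less_iff[of x j q i] Q_subset[of j] show "x \<in> {x \<in> N. state_less x q}" by auto
    qed
  qed
  finally show ?thesis .
qed simp

section \<open>The maps \<open>\<nu>\<close> of each level\<close>

lemma irreflp_less_option: "irreflp (less_q_option k N Q)"
proof (rule irreflpI)
  fix s show "\<not> less_q_option k N Q s s"
    using irreflp_state_less by (cases s) (auto simp: irreflp_def)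
qed

lemma transp_less_option: "transp (less_q_option k N Q)"
proof (rule transpI)
  fix s t u assume "less_q_option k N Q s t" "less_q_option k N Q t u"
  then show "less_q_option k N Q s u"
    by (cases s; cases t; cases u) (auto intro: transpD[OF transp_state_less])
qed

lemma totalp_less_option: "totalp_on (insert None (Some ` N)) (less_q_option k N Q)"
  using totalp_state_less by (auto simp: totalp_on_def)

lemma irreflp_less_nu: "irreflp (less_nu \<Sigma> N Q)"
  using irreflp_less_option unfolding irreflp_def less_nu_def
  by (auto intro!: lexord_irreflexive)

lemma transp_less_nu: "transp (less_nu \<Sigma> N Q)"
proof (rule transpI)
  have "trans {(s, t). less_q_option k N Q s t}"
    using transp_less_option by (auto simp: trans_def transp_def)
  then show "less_nu \<Sigma> N Q x z" if "less_nu \<Sigma> N Q x y" "less_nu \<Sigma> N Q y z" for x y z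
    using that unfolding less_nu_def by (blast intro: lexord_trans)
qed

lemma nu_set_letters:
  assumes "p \<in> {1..n}" "\<nu> \<in> nu_set \<Sigma> N Q p" "a \<in> \<Sigma>"
  shows "\<nu> a \<in> insert None (Some ` N)"
proof -
  have "\<nu> a \<in> qs ` {0..p - 1}" using assms by (auto simp: nu_set_def)
  also have "\<dots> \<subseteq> qs ` {0..n}" using assms(1) by (intro image_mono) auto
  also note qs_image
  finally show ?thesis .
qed

lemma totalp_less_nu:
  assumes p: "p \<in> {1..n}"
  shows "totalp_on (nu_set \<Sigma> N Q p) (less_nu \<Sigma> N Q)"
proof (rule totalp_onI)
  fix \<nu> \<nu>' assume \<nu>: "\<nu> \<in> nu_set \<Sigma> N Q p" "\<nu>' \<in> nu_set \<Sigma> N Q p" "\<nu> \<noteq> \<nu>'"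
  let ?L = "sorted_list_of_set \<Sigma>"
  have "\<nu> \<in> extensional \<Sigma>" "\<nu>' \<in> extensional \<Sigma>"
    using \<nu>(1,2) unfolding nu_set_def PiE_def by blast+
  then have "\<exists>a\<in>\<Sigma>. \<nu> a \<noteq> \<nu>' a"
    using extensionalityI \<nu>(3) by metis
  then have "map \<nu> ?L \<noteq> map \<nu>' ?L" using finite_alphabet by auto
  moreover have "set (map \<nu> ?L) \<subseteq> insert None (Some ` N)" "set (map \<nu>' ?L) \<subseteq> insert None (Some ` N)"
    unfolding set_map set_sorted_list_of_set[OF finite_alphabet]
    by (rule image_subsetI, rule nu_set_letters[OF p \<nu>(1)], assumption)
      (rule image_subsetI, rule nu_set_letters[OF p \<nu>(2)], assumption)
  ultimately show "less_nu \<Sigma> N Q \<nu> \<nu>' \<or> less_nu \<Sigma> N Q \<nu>' \<nu>"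
    unfolding less_nu_def
    by (intro lexord_total_on[where T = "insert None (Some ` N)"])
      (use totalp_onD[OF totalp_less_option] in \<open>simp_all del: set_map\<close>)
qed

lemma finite_nu_set: "finite (nu_set \<Sigma> N Q p)"
  unfolding nu_set_def by (rule finite_subset[OF Collect_restrict]) (simp add: finite_PiE finite_alphabet)

lemma card_nu_set:
  assumes p: "p \<in> {1..n}"
  shows "card (nu_set \<Sigma> N Q p) = p ^ k - (p - 1) ^ k"
proof -
  have inj: "inj_on qs (insert (p - 1) {0..<p - 1})"
    using p by (intro inj_on_subset[OF inj_qs]) auto
  then have "inj_on qs {0..<p - 1}" "qs (p - 1) \<notin> qs ` {0..<p - 1}"
    by (simp_all only: inj_on_insert) simp
  moreover have "nu_set \<Sigma> N Q p =
      {\<nu> \<in> \<Sigma> \<rightarrow>\<^sub>E insert (qs (p - 1)) (qs ` {0..<p - 1}). \<exists>a\<in>\<Sigma>. \<nu> a = qs (p - 1)}"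
  proof -
    have "{0..p - 1} = insert (p - 1) {0..<p - 1}" by auto
    then show ?thesis unfolding nu_set_def by (simp only: image_insert)
  qed
  ultimately show ?thesis
    using p by (simp add: card_PiE_hitting finite_alphabet card_image)
qed

lemma nu_in_nu_set:
  assumes "p \<in> {1..n}" "j \<in> {1..p ^ k - (p - 1) ^ k}"
  shows "nu \<Sigma> N Q p j \<in> nu_set \<Sigma> N Q p"
proof -
  note enum = finite_nu_set[of p] transp_less_nu irreflp_less_nu totalp_less_nu[OF assms(1)]
  have "j - 1 < length (enumeration (less_nu \<Sigma> N Q) (nu_set \<Sigma> N Q p))"
    using assms(2) by (auto simp: enumeration_distinct(2)[OF enum] card_nu_set[OF assms(1)])
  from nth_mem[OF this] show ?thesis
    unfolding nu_def enumeration_sorted(2)[OF enum] .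
qed

text \<open>The level can be recovered from the map: it is one more than the largest index of a letter
  that occurs.\<close>

lemma nu_set_disjoint:
  assumes "p \<in> {1..n}" "p' \<in> {1..n}" "\<nu> \<in> nu_set \<Sigma> N Q p" "\<nu> \<in> nu_set \<Sigma> N Q p'"
  shows "p = p'"
proof -
  have le: "v \<le> u"
    if v: "v \<in> {1..n}" "\<nu> \<in> nu_set \<Sigma> N Q v" and u: "u \<in> {1..n}" "\<nu> \<in> nu_set \<Sigma> N Q u" for u v
  proof -
    obtain a where a: "a \<in> \<Sigma>" "\<nu> a = qs (v - 1)" using v(2) unfolding nu_set_def by blast
    then have "qs (v - 1) \<in> qs ` {0..u - 1}"
      using u(2) unfolding nu_set_def PiE_iff mem_Collect_eq by metis
    moreover have "{0..u - 1} \<subseteq> {0..n}" "v - 1 \<in> {0..n}" using u(1) v(1) by auto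
    ultimately have "v - 1 \<in> {0..u - 1}" using inj_on_image_mem_iff[OF inj_qs] by blast
    then show ?thesis using u(1) v(1) by auto
  qed
  show ?thesis using le[of p p'] le[of p' p] assms by auto
qed

lemma nu_inj:
  assumes "p \<in> {1..n}" "j \<in> {1..p ^ k - (p - 1) ^ k}" "p' \<in> {1..n}" "j' \<in> {1..p' ^ k - (p' - 1) ^ k}"
    and eq: "\<And>a. a \<in> \<Sigma> \<Longrightarrow> nu \<Sigma> N Q p j a = nu \<Sigma> N Q p' j' a"
  shows "p = p' \<and> j = j'"
proof -
  have mem: "nu \<Sigma> N Q p j \<in> nu_set \<Sigma> N Q p" "nu \<Sigma> N Q p' j' \<in> nu_set \<Sigma> N Q p'"
    using assms nu_in_nu_set by auto
  then have fun_eq: "nu \<Sigma> N Q p j = nu \<Sigma> N Q p' j'"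
    using eq unfolding nu_set_def PiE_iff by (blast intro: extensionalityI)
  with mem have p: "p = p'" using nu_set_disjoint assms by metis
  note enum = finite_nu_set[of p] transp_less_nu irreflp_less_nu totalp_less_nu[OF assms(1)]
  have "j - 1 = j' - 1"
  proof (rule iffD1[OF nth_eq_iff_index_eq])
    show "distinct (enumeration (less_nu \<Sigma> N Q) (nu_set \<Sigma> N Q p))"
      by (rule enumeration_distinct(1)[OF enum])
    show "enumeration (less_nu \<Sigma> N Q) (nu_set \<Sigma> N Q p) ! (j - 1) =
        enumeration (less_nu \<Sigma> N Q) (nu_set \<Sigma> N Q p) ! (j' - 1)"
      using fun_eq unfolding nu_def p .
    show "j - 1 < length (enumeration (less_nu \<Sigma> N Q) (nu_set \<Sigma> N Q p))"
      "j' - 1 < length (enumeration (less_nu \<Sigma> N Q) (nu_set \<Sigma> N Q p))"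
      using assms(2,4) p unfolding enumeration_distinct(2)[OF enum] card_nu_set[OF assms(1)] by auto
  qed
  then show ?thesis using p assms(2,4) by auto
qed

text \<open>A map of level \<open>p\<close> takes the value \<^term>\<open>qs (p - 1)\<close>, which is a state unless \<open>p = 1\<close>; at level 1
  the absorbing state is the only available value.\<close>

lemma nu_eq_None_iff:
  assumes "p \<in> {1..n}" "j \<in> {1..p ^ k - (p - 1) ^ k}"
  shows "(\<forall>a\<in>\<Sigma>. nu \<Sigma> N Q p j a = None) \<longleftrightarrow> p = 1"
proof -
  have mem: "nu \<Sigma> N Q p j \<in> nu_set \<Sigma> N Q p" using nu_in_nu_set[OF assms] .
  show ?thesis
  proof
    assume "\<forall>a\<in>\<Sigma>. nu \<Sigma> N Q p j a = None"
    then have "qs (p - 1) = None" using mem unfolding nu_set_def by force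
    then show "p = 1" using assms(1) by simp
  next
    assume "p = 1"
    then show "\<forall>a\<in>\<Sigma>. nu \<Sigma> N Q p j a = None"
      using mem unfolding nu_set_def by (auto simp: PiE_iff)
  qed
qed

section \<open>The automaton of a parking function\<close>

text \<open>The index pairs \<open>{2c - 1, 2c}\<close> are the fibres of \<open>\<lambda>i. (i + 1) div 2\<close>. Decoding \<open>c\<close> into level and
  offset therefore identifies the unique pair chosen by \<^const>\<open>zeta_index\<close>.\<close>

lemma zeta_index:
  assumes q: "q \<in> Q i" and i: "i \<in> {1..2 * n ^ k}"
  obtains p j where "zeta_index k N Q q = (p, j)" "p \<in> {1..n}" "j \<in> {1..p ^ k - (p - 1) ^ k}"
    "(i + 1) div 2 = (p - 1) ^ k + j"
proof -
  have "1 \<le> (i + 1) div 2" "(i + 1) div 2 \<le> n ^ k" using i by auto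
  then obtain p j where pj: "p \<in> {1..n}" "j \<in> {1..p ^ k - (p - 1) ^ k}" "(i + 1) div 2 = (p - 1) ^ k + j"
    using power_block_exists k_pos by blast
  have half: "(q \<in> Q (2 * (u - 1) ^ k + 2 * v - 1) \<or> q \<in> Q (2 * (u - 1) ^ k + 2 * v)) \<longleftrightarrow>
      (i + 1) div 2 = (u - 1) ^ k + v"
    if "u \<in> {1..n}" "v \<in> {1..u ^ k - (u - 1) ^ k}" for u v
  proof -
    have "u ^ k \<le> n ^ k" using that by (intro power_mono) auto
    then have "2 * (u - 1) ^ k + 2 * v \<le> 2 * n ^ k" using that by auto
    then have range: "2 * (u - 1) ^ k + 2 * v - 1 \<in> {1..2 * n ^ k}" "2 * (u - 1) ^ k + 2 * v \<in> {1..2 * n ^ k}"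
      using that by auto
    then have "(q \<in> Q (2 * (u - 1) ^ k + 2 * v - 1) \<or> q \<in> Q (2 * (u - 1) ^ k + 2 * v)) \<longleftrightarrow>
      i = 2 * (u - 1) ^ k + 2 * v - 1 \<or> i = 2 * (u - 1) ^ k + 2 * v"
      using Q_unique[OF q _ i] q by blast
    also have "\<dots> \<longleftrightarrow> (i + 1) div 2 = (u - 1) ^ k + v"
      using that(2) i by auto
    finally show ?thesis .
  qed
  have "zeta_index k N Q q = (p, j)"
    unfolding zeta_index_def
  proof (rule the_equality)
    show "case (p, j) of (p, j) \<Rightarrow> p \<in> {1..n} \<and> j \<in> {1..p ^ k - (p - 1) ^ k} \<and>
        (q \<in> Q (2 * (p - 1) ^ k + 2 * j - 1) \<or> q \<in> Q (2 * (p - 1) ^ k + 2 * j))"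
      using half[OF pj(1,2)] pj by simp
  next
    fix uv :: "nat \<times> nat"
    assume "case uv of (p, j) \<Rightarrow> p \<in> {1..n} \<and> j \<in> {1..p ^ k - (p - 1) ^ k} \<and>
        (q \<in> Q (2 * (p - 1) ^ k + 2 * j - 1) \<or> q \<in> Q (2 * (p - 1) ^ k + 2 * j))"
    then obtain u v where uv: "uv = (u, v)" "u \<in> {1..n}" "v \<in> {1..u ^ k - (u - 1) ^ k}"
        "q \<in> Q (2 * (u - 1) ^ k + 2 * v - 1) \<or> q \<in> Q (2 * (u - 1) ^ k + 2 * v)"
      by (cases uv) simp
    then have "(u - 1) ^ k + v = (p - 1) ^ k + j" using half[OF uv(2,3)] pj(3) by simp
    then show "uv = (p, j)" using power_block_unique[OF uv(3) pj(2)] uv(1) by simp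
  qed
  then show thesis using that pj by blast
qed

lemma zeta_accepting_iff:
  assumes "q \<in> Q i" "i \<in> {1..2 * n ^ k}"
  shows "q \<in> fst (zeta \<Sigma> N Q) \<longleftrightarrow> even i"
proof -
  have "q \<in> fst (zeta \<Sigma> N Q) \<longleftrightarrow> (\<exists>i'\<in>{1..2 * n ^ k}. even i' \<and> q \<in> Q i')"
    unfolding zeta_def by auto
  also have "\<dots> \<longleftrightarrow> even i" using assms Q_unique[OF _ assms(1) _ assms(2)] by blast
  finally show ?thesis .
qed

text \<open>Acyclicity of \<open>\<zeta>(Q)\<close>, with the number of preceding states as the rank: a target \<open>q\<^sub>m\<close>
  with \<open>1 \<le> m \<le> p - 1\<close> has rank \<open>m - 1\<close>, and the source has rank at least \<open>p - 1\<close>.\<close>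

lemma zeta_step:
  assumes q: "q \<in> N" and a: "a \<in> \<Sigma>" and r: "snd (zeta \<Sigma> N Q) q a = Some r"
  shows "r \<in> N \<and> rank r < rank q"
proof -
  obtain i where i: "i \<in> {1..2 * n ^ k}" "q \<in> Q i" using Q_cover[OF q] by blast
  obtain p j where pj: "zeta_index k N Q q = (p, j)" "p \<in> {1..n}" "j \<in> {1..p ^ k - (p - 1) ^ k}"
    "(i + 1) div 2 = (p - 1) ^ k + j" using zeta_index[OF i(2,1)] .
  have \<nu>: "nu \<Sigma> N Q p j a = Some r" using r pj(1) by (simp add: zeta_def)
  have mem: "nu \<Sigma> N Q p j \<in> nu_set \<Sigma> N Q p" using nu_in_nu_set[OF pj(2,3)] .
  then have "Some r \<in> qs ` {0..p - 1}"
    using a unfolding nu_set_def PiE_iff \<nu>[symmetric] by blast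
  then obtain m where m: "m \<le> p - 1" "qs m = Some r" by auto
  then have "m \<noteq> 0" using qs_eq_None_iff[of m] by auto
  then have "r = order_list ! (m - 1)" "m - 1 < n" using m pj(2) by (auto simp: q_seq_def)
  then have "r \<in> N" "rank r = m - 1" using rank_nth order_list(2,4) nth_mem by auto
  moreover have "2 * (p - 1) ^ k < i" using pj(3,4) by auto
  then have "p - 1 \<le> rank q" using rank_ge_of_block i pj(2) by blast
  ultimately show ?thesis using m \<open>m \<noteq> 0\<close> by auto
qed

lemma zeta_transitions_eq_iff:
  assumes "q \<in> Q i" "i \<in> {1..2 * n ^ k}" "r \<in> Q i'" "i' \<in> {1..2 * n ^ k}"
  shows "(\<forall>a\<in>\<Sigma>. snd (zeta \<Sigma> N Q) q a = snd (zeta \<Sigma> N Q) r a) \<longleftrightarrow> (i + 1) div 2 = (i' + 1) div 2"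
proof -
  obtain p j where pj: "zeta_index k N Q q = (p, j)" "p \<in> {1..n}" "j \<in> {1..p ^ k - (p - 1) ^ k}"
    "(i + 1) div 2 = (p - 1) ^ k + j" using zeta_index[OF assms(1,2)] .
  obtain p' j' where pj': "zeta_index k N Q r = (p', j')" "p' \<in> {1..n}" "j' \<in> {1..p' ^ k - (p' - 1) ^ k}"
    "(i' + 1) div 2 = (p' - 1) ^ k + j'" using zeta_index[OF assms(3,4)] .
  have "(\<forall>a\<in>\<Sigma>. snd (zeta \<Sigma> N Q) q a = snd (zeta \<Sigma> N Q) r a) \<longleftrightarrow>
      (\<forall>a\<in>\<Sigma>. nu \<Sigma> N Q p j a = nu \<Sigma> N Q p' j' a)"
    by (simp add: zeta_def pj(1) pj'(1))
  also have "\<dots> \<longleftrightarrow> p = p' \<and> j = j'" using nu_inj[OF pj(2,3) pj'(2,3)] by auto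
  also have "\<dots> \<longleftrightarrow> (i + 1) div 2 = (i' + 1) div 2"
    using power_block_unique[OF pj(3) pj'(3)] pj(4) pj'(4) by auto
  finally show ?thesis .
qed

lemma zeta_transitions_None_iff:
  assumes "q \<in> Q i" "i \<in> {1..2 * n ^ k}"
  shows "(\<forall>a\<in>\<Sigma>. snd (zeta \<Sigma> N Q) q a = None) \<longleftrightarrow> i \<le> 2"
proof -
  obtain p j where pj: "zeta_index k N Q q = (p, j)" "p \<in> {1..n}" "j \<in> {1..p ^ k - (p - 1) ^ k}"
    "(i + 1) div 2 = (p - 1) ^ k + j" using zeta_index[OF assms] .
  have "(\<forall>a\<in>\<Sigma>. snd (zeta \<Sigma> N Q) q a = None) \<longleftrightarrow> p = 1"
    using nu_eq_None_iff[OF pj(2,3)] by (simp add: zeta_def pj(1))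
  also have "p = 1 \<longleftrightarrow> (i + 1) div 2 = 1"
  proof
    assume "p = 1"
    then show "(i + 1) div 2 = 1" using pj(3,4) k_pos by (auto simp: power_0_left)
  next
    assume "(i + 1) div 2 = 1"
    moreover have "1 \<le> j" using pj(3) by simp
    ultimately have "(p - 1) ^ k = 0" using pj(4) by linarith
    then show "p = 1" using pj(2) by auto
  qed
  also have "\<dots> \<longleftrightarrow> i \<le> 2" using assms(2) by auto
  finally show ?thesis .
qed

text \<open>Acceptance gives the parity of the index and the transitions give its pair \<open>{2c - 1, 2c}\<close>,
  so together they give the index and nothing more.\<close>

lemma zeta_state_determined_iff:
  "(\<forall>q\<in>N. \<forall>r\<in>N. (q \<in> fst (zeta \<Sigma> N Q) \<longleftrightarrow> r \<in> fst (zeta \<Sigma> N Q)) \<and>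
      (\<forall>a\<in>\<Sigma>. snd (zeta \<Sigma> N Q) q a = snd (zeta \<Sigma> N Q) r a) \<longrightarrow> q = r) \<longleftrightarrow>
   (\<forall>i\<in>{1..2 * n ^ k}. card (Q i) \<le> 1)" (is "?det \<longleftrightarrow> ?small")
proof -
  have "?det \<longleftrightarrow> (\<forall>i\<in>{1..2 * n ^ k}. \<forall>q\<in>Q i. \<forall>r\<in>Q i. q = r)"
  proof (intro iffI ballI impI)
    fix i q r assume det: "?det" and i: "i \<in> {1..2 * n ^ k}" and q: "q \<in> Q i" and r: "r \<in> Q i"
    have "q \<in> fst (zeta \<Sigma> N Q) \<longleftrightarrow> r \<in> fst (zeta \<Sigma> N Q)"
      using zeta_accepting_iff[OF q i] zeta_accepting_iff[OF r i] by simp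
    moreover have "\<forall>a\<in>\<Sigma>. snd (zeta \<Sigma> N Q) q a = snd (zeta \<Sigma> N Q) r a"
      using zeta_transitions_eq_iff[OF q i r i] by simp
    moreover have "q \<in> N" "r \<in> N" using Q_subset[OF i] q r by blast+
    ultimately show "q = r" using det by simp
  next
    fix q r
    assume inj: "\<forall>i\<in>{1..2 * n ^ k}. \<forall>q\<in>Q i. \<forall>r\<in>Q i. q = r" and N: "q \<in> N" "r \<in> N"
      and eq: "(q \<in> fst (zeta \<Sigma> N Q) \<longleftrightarrow> r \<in> fst (zeta \<Sigma> N Q)) \<and>
        (\<forall>a\<in>\<Sigma>. snd (zeta \<Sigma> N Q) q a = snd (zeta \<Sigma> N Q) r a)"
    obtain i i' where i: "i \<in> {1..2 * n ^ k}" "q \<in> Q i" and i': "i' \<in> {1..2 * n ^ k}" "r \<in> Q i'"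
      using Q_cover N by metis
    have "even i \<longleftrightarrow> even i'" "(i + 1) div 2 = (i' + 1) div 2"
      using eq zeta_accepting_iff[OF i(2,1)] zeta_accepting_iff[OF i'(2,1)]
        zeta_transitions_eq_iff[OF i(2,1) i'(2,1)] by auto
    then have "i = i'" by presburger
    then show "q = r" using inj i i' by blast
  qed
  also have "\<dots> \<longleftrightarrow> ?small"
    using finite_subset[OF Q_subset finite_states] by (simp add: card_le_Suc0_iff_eq)
  finally show ?thesis .
qed

text \<open>The indices of states without transitions into \<open>N\<close> are 1 and 2, and only the odd one is
  non-accepting.\<close>

lemma zeta_no_dead_state_iff:
  "(\<forall>q\<in>N. q \<in> fst (zeta \<Sigma> N Q) \<or> (\<exists>a\<in>\<Sigma>. snd (zeta \<Sigma> N Q) q a \<noteq> None)) \<longleftrightarrow> Q 1 = {}"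
proof -
  have one: "1 \<in> {1..2 * n ^ k}" using n_pos by (auto simp: Suc_le_eq)
  have "(q \<in> fst (zeta \<Sigma> N Q) \<or> (\<exists>a\<in>\<Sigma>. snd (zeta \<Sigma> N Q) q a \<noteq> None)) \<longleftrightarrow> q \<notin> Q 1"
    if q: "q \<in> N" for q
  proof -
    obtain i where i: "i \<in> {1..2 * n ^ k}" "q \<in> Q i" using Q_cover[OF q] by blast
    have "odd i \<and> i \<le> 2 \<longleftrightarrow> i = 1" using i(1) by auto presburger
    moreover have "i = 1 \<longleftrightarrow> q \<in> Q 1"
      using Q_unique[OF i(2) _ i(1) one] i(2) by auto
    ultimately show ?thesis
      using zeta_accepting_iff[OF i(2,1)] zeta_transitions_None_iff[OF i(2,1)] by metis
  qed
  then have "(\<forall>q\<in>N. q \<in> fst (zeta \<Sigma> N Q) \<or> (\<exists>a\<in>\<Sigma>. snd (zeta \<Sigma> N Q) q a \<noteq> None)) \<longleftrightarrow>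
      (\<forall>q\<in>N. q \<notin> Q 1)"
    by (rule ball_cong[OF refl])
  also have "\<dots> \<longleftrightarrow> Q 1 = {}" using Q_subset[OF one] by auto
  finally show ?thesis .
qed

end

theorem lemma4:
  fixes \<Sigma> :: "'a::linorder set" and N :: "'q::linorder set"
    and Q :: "nat \<Rightarrow> 'q set" and k n :: nat
  assumes "finite \<Sigma>" and "card \<Sigma> = k" and "k \<ge> 1"
    and "finite N" and "N \<noteq> {}" and "card N = n"
    and "parking_function k N Q"
  shows "simple \<Sigma> N (zeta \<Sigma> N Q) \<and> coreachable \<Sigma> N (zeta \<Sigma> N Q) \<longleftrightarrow>
         (\<forall>j\<in>{1..2 * n ^ k}. card (Q j) \<le> 1) \<and> Q 1 = {}"
proof -
  interpret parking \<Sigma> N Q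
    using assms by unfold_locales auto
  show ?thesis
    using simple_coreachable_iff[of N \<Sigma> "zeta \<Sigma> N Q" rank, OF zeta_step]
      zeta_state_determined_iff zeta_no_dead_state_iff assms(2,6) by simp
qed

end
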